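(* For the even-signed permutation group $D_n$, $$\sum_{\pi\in D_n}(-1)^{\ell_D(\pi)}q^{\mathrm{sor}_D(\pi)} = \prod_{k=2}^n \left( 1-(q+q^{k-1})[k-1]_q+q^{2k-2} \right).$$
   Context: For an integer $m\ge 0$, $[m]_q:=1+q+\cdots+q^{m-1}$. $B_n$ is the group of signed permutations: bijections $\pi$ of $\{\pm1,\dots,\pm n\}$ with $\pi(-i)=-\pi(i)$, written $\pi=\pi_1\cdots\pi_n$ with $\pi_i=\pi(i)$; multiplication is composition $(\pi\rho)(x)=\pi(\rho(x))$. We write $\bar i=-i$. Put $\mathrm{Neg}(\pi):=\{i\in\{1,\dots,n\}:\pi_i<0\}$ and $\mathrm{neg}(\pi):=|\mathrm{Neg}(\pi)|$. $D_n:=\{\pi\in B_n:\mathrm{neg}(\pi)\text{ is even}\}$. With respect to the usual order of the integers, $\mathrm{inv}(\pi):=|\{(i,j):1\le i<j\le n,\ \pi_i>\pi_j\}|$. $\ell_D$ is the Coxeter length function of $D_n$ with respect to the generators $s_0'=(\bar 1,2)$ (exchanging $-1$ with $2$ and $1$ with $-2$) and $s_i=(i,i+1)$, $1\le i\le n-1$; it satisfies $\ell_D(\pi)=\mathrm{inv}(\pi)-\mathrm{neg}(\pi)-\sum_{i\in\mathrm{Neg}(\pi)}\pi_i$. For $1\le|i|<j\le n$ ($i$ possibly negative) let $t_{i,j}=(i,j)$ be the element exchanging $i$ with $j$ and $-i$ with $-j$; for $1<i\le n$ let $t_{\bar i,i}=(\bar1,1)(\bar i,i)$, the element changing the signs of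 both $1$ and $i$. Every $\pi\in D_n$ has a unique factorization $\pi=t_{i_1,j_1}t_{i_2,j_2}\cdots t_{i_m,j_m}$ into such elements with $0<j_1<j_2<\cdots<j_m\le n$, $m\ge 0$ (for a factor $t_{\bar i,i}$ the pair of indices is $(-i,i)$). The type $D$ sorting index is $$\mathrm{sor}_D(\pi):=\sum_{s=1}^m\big(j_s-i_s-2\,\delta(i_s<0)\big),$$ where $\delta(\mathsf A)=1$ if $\mathsf A$ is true and $0$ otherwise. *)

theory Defs
  imports "HOL-Combinatorics.Transposition" "HOL-Combinatorics.Permutations" Complex_Main
begin

definition qint :: "'a::comm_ring_1 \<Rightarrow> nat \<Rightarrow> 'a" where
  "qint q m = (\<Sum>i<m. q ^ i)"

text \<open>A signed permutation is a function on all integers that fixes everything outside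
  \<open>{\<plusminus>1, \<dots>, \<plusminus>n}\<close>; multiplication is function composition \<open>(\<circ>)\<close>.\<close>

definition signed_perms :: "nat \<Rightarrow> (int \<Rightarrow> int) set" where
  "signed_perms n =
     {\<pi>. \<pi> permutes ({- int n..int n} - {0}) \<and> (\<forall>i. \<pi> (- i) = - \<pi> i)}"

definition Neg :: "nat \<Rightarrow> (int \<Rightarrow> int) \<Rightarrow> int set" where
  "Neg n \<pi> = {i \<in> {1..int n}. \<pi> i < 0}"

definition neg :: "nat \<Rightarrow> (int \<Rightarrow> int) \<Rightarrow> nat" where
  "neg n \<pi> = card (Neg n \<pi>)"

definition even_signed_perms :: "nat \<Rightarrow> (int \<Rightarrow> int) set" where
  "even_signed_perms n = {\<pi> \<in> signed_perms n. even (neg n \<pi>)}"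

definition compose_list :: "('a \<Rightarrow> 'a) list \<Rightarrow> 'a \<Rightarrow> 'a" where
  "compose_list fs = foldr (\<circ>) fs id"

text \<open>The element \<open>t\<^sub>i\<^sub>,\<^sub>j\<close>. For \<open>i = -j\<close> it changes the signs of both \<open>1\<close> and \<open>j\<close>.
  Only the index pairs in \<open>index_pairs n\<close> below are meaningful.\<close>

definition signed_transp :: "int \<Rightarrow> int \<Rightarrow> int \<Rightarrow> int" where
  "signed_transp i j =
     (if i = - j then transpose (- 1) 1 \<circ> transpose (- j) j
      else transpose i j \<circ> transpose (- i) (- j))"

text \<open>The generator \<open>s\<^sub>0'\<close> exchanges \<open>-1\<close> with \<open>2\<close>, hence exists only for \<open>n \<ge> 2\<close>.\<close>

definition D_generators :: "nat \<Rightarrow> (int \<Rightarrow> int) set" where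
  "D_generators n =
     (if n \<ge> 2 then {signed_transp (- 1) 2} else {}) \<union>
     {signed_transp i (i + 1) |i. 1 \<le> i \<and> i \<le> int n - 1}"

text \<open>Words need no inverses of generators, as all generators are involutions.\<close>

definition length_D :: "nat \<Rightarrow> (int \<Rightarrow> int) \<Rightarrow> nat" where
  "length_D n \<pi> =
     (LEAST k. \<exists>ws. set ws \<subseteq> D_generators n \<and> length ws = k \<and> compose_list ws = \<pi>)"

definition index_pairs :: "nat \<Rightarrow> (int \<times> int) set" where
  "index_pairs n =
     {(i, j). 1 \<le> \<bar>i\<bar> \<and> \<bar>i\<bar> < j \<and> j \<le> int n} \<union> {(- i, i) |i. 1 < i \<and> i \<le> int n}"

definition is_factorization :: "nat \<Rightarrow> (int \<Rightarrow> int) \<Rightarrow> (int \<times> int) list \<Rightarrow> bool" where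
  "is_factorization n \<pi> ps \<longleftrightarrow>
     set ps \<subseteq> index_pairs n \<and> sorted_wrt (<) (map snd ps) \<and>
     \<pi> = compose_list (map (\<lambda>(i, j). signed_transp i j) ps)"

text \<open>Every summand is nonnegative (indeed positive) on \<open>index_pairs n\<close>, so \<open>nat\<close>
  does not truncate.\<close>

definition sor_D :: "nat \<Rightarrow> (int \<Rightarrow> int) \<Rightarrow> nat" where
  "sor_D n \<pi> =
     nat (\<Sum>(i, j) \<leftarrow> (THE ps. is_factorization n \<pi> ps). j - i - 2 * of_bool (i < 0))"

end

theory Submission imports Defs begin

text \<open>
  Write \<open>t\<^sub>1 \<circ> \<dots> \<circ> t\<^sub>m\<close> for the factorization of \<open>\<pi> \<in> D\<^sub>n\<close> into elements \<open>t\<^sub>i\<^sub>,\<^sub>k\<close> with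
  increasing second indices. Both ingredients of the sum are multiplicative over this factorization, so the
  generating function over \<open>D\<^sub>n\<close> splits into one factor for each possible second index \<open>k\<close>.

  For the sorting index this is its definition. For the length, only the parity matters.
  Forgetting signs, that is \<open>\<pi> \<mapsto> \<bar>\<pi>\<bar>\<close>, is a homomorphism onto the symmetric group that maps every
  Coxeter generator of \<open>D\<^sub>n\<close> to an adjacent transposition. Hence the parity of a word in the
  generators is \<open>sign \<bar>\<pi>\<bar>\<close> (\<open>length_D_parity\<close>). This character is \<open>-1\<close> on every \<open>t\<^sub>i\<^sub>,\<^sub>k\<close> with
  \<open>\<bar>i\<bar> < k\<close>, which becomes the transposition \<open>(\<bar>i\<bar>, k)\<close>, and \<open>1\<close> on \<open>t\<^sub>-\<^sub>k\<^sub>,\<^sub>k\<close>, which only changes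
  signs.

  Every choice of at most one first index for each \<open>k\<close> gives a different element of \<open>D\<^sub>n\<close>, and all
  of \<open>D\<^sub>n\<close> arises (\<open>bij_betw_factor_prod\<close>). Indeed, the factor with second index
  \<open>n\<close>, if any, can be read off the preimage of \<open>n\<close>, and removing it leaves an element that
  fixes \<open>n\<close>, hence an element of \<open>D\<^sub>n\<^sub>-\<^sub>1\<close>.

  It remains to add up the contributions for fixed \<open>k\<close> (\<open>sum_top_indices\<close>). Having no factor
  contributes \<open>1\<close>; the indices \<open>i = k-1, \<dots>, 1\<close> contribute \<open>-q, \<dots>, -q\<^sup>k\<^sup>-\<^sup>1\<close>; the indices
  \<open>i = -1, \<dots>, -(k-1)\<close> contribute \<open>-q\<^sup>k\<^sup>-\<^sup>1, \<dots>, -q\<^sup>2\<^sup>k\<^sup>-\<^sup>3\<close>; and \<open>i = -k\<close> contributes \<open>q\<^sup>2\<^sup>k\<^sup>-\<^sup>2\<close>.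
\<close>

section \<open>The group of signed permutations\<close>

lemma compose_list_simps [simp]:
  "compose_list [] = id" "compose_list (f # fs) = f \<circ> compose_list fs"
  by (simp_all add: compose_list_def)

lemma compose_list_append [simp]:
  "compose_list (fs @ gs) = compose_list fs \<circ> compose_list gs"
  by (induction fs) (simp_all add: comp_assoc)

lemma signed_perms_permutes:
  "\<pi> \<in> signed_perms n \<Longrightarrow> \<pi> permutes ({- int n..int n} - {0})"
  by (simp add: signed_perms_def)

lemma signed_perms_minus: "\<pi> \<in> signed_perms n \<Longrightarrow> \<pi> (- i) = - \<pi> i"
  by (simp add: signed_perms_def)

lemma signed_perms_inject: "\<pi> \<in> signed_perms n \<Longrightarrow> \<pi> i = \<pi> j \<longleftrightarrow> i = j"
  using signed_perms_permutes permutes_inj inj_eq by metis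

lemma signed_perms_eq_0_iff: "\<pi> \<in> signed_perms n \<Longrightarrow> \<pi> i = 0 \<longleftrightarrow> i = 0"
  using signed_perms_inject[of \<pi> n i 0] permutes_not_in[OF signed_perms_permutes, of \<pi> n 0]
  by simp

lemma signed_perms_fixes: "\<pi> \<in> signed_perms n \<Longrightarrow> \<bar>i\<bar> > int n \<Longrightarrow> \<pi> i = i"
  by (rule permutes_not_in[OF signed_perms_permutes]) auto

lemma signed_perms_abs_le_iff: "\<pi> \<in> signed_perms n \<Longrightarrow> \<bar>\<pi> i\<bar> \<le> int n \<longleftrightarrow> \<bar>i\<bar> \<le> int n"
  using permutes_in_image[OF signed_perms_permutes, of \<pi> n i] signed_perms_eq_0_iff[of \<pi> n i]
  by fastforce

lemma signed_perms_id: "id \<in> signed_perms n"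
  by (simp add: signed_perms_def permutes_id)

lemma signed_perms_compose:
  "\<pi> \<in> signed_perms n \<Longrightarrow> \<rho> \<in> signed_perms n \<Longrightarrow> \<pi> \<circ> \<rho> \<in> signed_perms n"
  by (simp add: signed_perms_def permutes_compose)

lemma compose_list_in_signed_perms:
  "set ws \<subseteq> signed_perms n \<Longrightarrow> compose_list ws \<in> signed_perms n"
  by (induction ws) (simp_all add: signed_perms_id signed_perms_compose)

text \<open>
  The group \<open>B\<^sub>n\<close> sits inside \<open>B\<^sub>n\<^sub>+\<^sub>1\<close> as the stabilizer of \<open>n + 1\<close>: as the elements are odd
  functions, the stabilizer also fixes \<open>-(n + 1)\<close>.
\<close>

lemma signed_perms_Suc_iff:
  "\<pi> \<in> signed_perms n \<longleftrightarrow> \<pi> \<in> signed_perms (Suc n) \<and> \<pi> (int (Suc n)) = int (Suc n)"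
proof
  assume \<pi>: "\<pi> \<in> signed_perms n"
  have "\<pi> permutes ({- int (Suc n)..int (Suc n)} - {0})"
    by (rule permutes_subset[OF signed_perms_permutes[OF \<pi>]]) auto
  then show "\<pi> \<in> signed_perms (Suc n) \<and> \<pi> (int (Suc n)) = int (Suc n)"
    using \<pi> signed_perms_fixes[OF \<pi>, of "int (Suc n)"] by (simp add: signed_perms_def)
next
  assume *: "\<pi> \<in> signed_perms (Suc n) \<and> \<pi> (int (Suc n)) = int (Suc n)"
  have fix_neg: "\<pi> (- int (Suc n)) = - int (Suc n)"
    using * signed_perms_minus by metis
  have "\<pi> permutes ({- int n..int n} - {0})"
  proof (rule permutes_superset)
    show "\<pi> permutes ({- int (Suc n)..int (Suc n)} - {0})"
      using * signed_perms_permutes by blast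
    fix x assume "x \<in> ({- int (Suc n)..int (Suc n)} - {0}) - ({- int n..int n} - {0})"
    then have "x = int (Suc n) \<or> x = - int (Suc n)" by auto
    then show "\<pi> x = x" using * fix_neg by metis
  qed
  then show "\<pi> \<in> signed_perms n" using * by (simp add: signed_perms_def)
qed

section \<open>The two linear characters\<close>

text \<open>
  The permutation of \<open>{1..n}\<close> that remains when the signs are forgotten. It is extended by the
  identity, so that \<open>permutes\<close> and \<open>sign\<close> apply to it.
\<close>

definition abs_perm :: "(int \<Rightarrow> int) \<Rightarrow> int \<Rightarrow> int" where
  "abs_perm \<pi> i = (if i > 0 then \<bar>\<pi> i\<bar> else i)"

lemma abs_perm_permutes:
  assumes \<pi>: "\<pi> \<in> signed_perms n"
  shows "abs_perm \<pi> permutes {1..int n}"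
proof (rule bij_imp_permutes)
  have inj: "inj_on (abs_perm \<pi>) {1..int n}"
  proof (rule inj_onI)
    fix i j assume ij: "i \<in> {1..int n}" "j \<in> {1..int n}" "abs_perm \<pi> i = abs_perm \<pi> j"
    then have "\<pi> i = \<pi> j \<or> \<pi> i = \<pi> (- j)"
      by (auto simp: abs_perm_def signed_perms_minus[OF \<pi>] abs_eq_iff)
    then show "i = j" using ij by (auto simp: signed_perms_inject[OF \<pi>])
  qed
  have "abs_perm \<pi> i \<in> {1..int n}" if "i \<in> {1..int n}" for i
    using that signed_perms_abs_le_iff[OF \<pi>, of i] signed_perms_eq_0_iff[OF \<pi>, of i]
    by (auto simp: abs_perm_def)
  then have "abs_perm \<pi> ` {1..int n} = {1..int n}"
    by (intro card_subset_eq) (auto simp: card_image[OF inj])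
  then show "bij_betw (abs_perm \<pi>) {1..int n} {1..int n}"
    using inj by (simp add: bij_betw_def)
  show "abs_perm \<pi> i = i" if "i \<notin> {1..int n}" for i
    using that signed_perms_fixes[OF \<pi>, of i] by (auto simp: abs_perm_def)
qed

lemma abs_perm_compose:
  assumes \<pi>: "\<pi> \<in> signed_perms n" and \<rho>: "\<rho> \<in> signed_perms n"
  shows "abs_perm (\<pi> \<circ> \<rho>) = abs_perm \<pi> \<circ> abs_perm \<rho>"
proof
  fix i
  have "\<bar>\<pi> x\<bar> = \<bar>\<pi> \<bar>x\<bar>\<bar>" for x
    by (cases "x \<ge> 0") (simp_all add: signed_perms_minus[OF \<pi>])
  then show "abs_perm (\<pi> \<circ> \<rho>) i = (abs_perm \<pi> \<circ> abs_perm \<rho>) i"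
    using signed_perms_eq_0_iff[OF \<rho>, of i] by (auto simp: abs_perm_def)
qed

lemma sign_abs_perm_compose:
  assumes "\<pi> \<in> signed_perms n" and "\<rho> \<in> signed_perms n"
  shows "sign (abs_perm (\<pi> \<circ> \<rho>)) = sign (abs_perm \<pi>) * sign (abs_perm \<rho>)"
proof -
  have "permutation (abs_perm \<sigma>)" if "\<sigma> \<in> signed_perms n" for \<sigma>
    using abs_perm_permutes[OF that] permutation_permutes by blast
  then show ?thesis
    using assms by (simp add: abs_perm_compose sign_compose)
qed

lemma sign_abs_perm_compose_list:
  assumes "set ws \<subseteq> signed_perms n"
  shows "sign (abs_perm (compose_list ws)) = (\<Prod>w\<leftarrow>ws. sign (abs_perm w))"
  using assms
proof (induction ws)
  case Nil
  have "abs_perm (\<lambda>a. a) = id" by (auto simp: abs_perm_def)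
  then show ?case by simp
next
  case (Cons w ws)
  then have "w \<in> signed_perms n" "compose_list ws \<in> signed_perms n"
    by (simp_all add: compose_list_in_signed_perms)
  from sign_abs_perm_compose[OF this] show ?case
    using Cons by (simp add: comp_def)
qed

text \<open>
  The parity of \<open>neg\<close> is handled through a product of signs, because such a product can be
  reindexed along the other permutation when two elements are composed.
\<close>

lemma prod_sgn_eq:
  assumes \<pi>: "\<pi> \<in> signed_perms n"
  shows "(\<Prod>i\<in>{1..int n}. sgn (\<pi> i)) = (- 1) ^ neg n \<pi>"
proof -
  have "(\<Prod>i\<in>{1..int n}. sgn (\<pi> i)) = (\<Prod>i\<in>{1..int n}. if \<pi> i < 0 then - 1 else 1)"
    using signed_perms_eq_0_iff[OF \<pi>] by (intro prod.cong) (auto simp: sgn_if)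
  also have "\<dots> = (\<Prod>i\<in>Neg n \<pi>. - 1)"
    unfolding Neg_def by (rule prod.inter_filter[symmetric]) simp
  finally show ?thesis by (simp add: neg_def)
qed

lemma even_neg_compose:
  assumes \<pi>: "\<pi> \<in> signed_perms n" and \<rho>: "\<rho> \<in> signed_perms n"
  shows "even (neg n (\<pi> \<circ> \<rho>)) \<longleftrightarrow> even (neg n \<pi> + neg n \<rho>)"
proof -
  have sgn_eq: "sgn (\<pi> x) = sgn x * sgn (\<pi> \<bar>x\<bar>)" for x
    using signed_perms_eq_0_iff[OF \<pi>, of 0]
    by (cases x "0::int" rule: linorder_cases) (simp_all add: signed_perms_minus[OF \<pi>])
  have "(\<Prod>i\<in>{1..int n}. sgn ((\<pi> \<circ> \<rho>) i))
      = (\<Prod>i\<in>{1..int n}. sgn (\<rho> i) * sgn (\<pi> (abs_perm \<rho> i)))"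
  proof (rule prod.cong)
    show "sgn ((\<pi> \<circ> \<rho>) i) = sgn (\<rho> i) * sgn (\<pi> (abs_perm \<rho> i))" if "i \<in> {1..int n}" for i
      using that sgn_eq[of "\<rho> i"] by (simp add: abs_perm_def)
  qed simp
  also have "\<dots> = (\<Prod>i\<in>{1..int n}. sgn (\<rho> i)) * (\<Prod>i\<in>{1..int n}. sgn (\<pi> (abs_perm \<rho> i)))"
    by (rule prod.distrib)
  also have "(\<Prod>i\<in>{1..int n}. sgn (\<pi> (abs_perm \<rho> i))) = (\<Prod>i\<in>{1..int n}. sgn (\<pi> i))"
    by (rule prod.reindex_bij_betw[OF permutes_imp_bij[OF abs_perm_permutes[OF \<rho>]]])
  finally have "(- 1 :: int) ^ neg n (\<pi> \<circ> \<rho>) = (- 1) ^ (neg n \<pi> + neg n \<rho>)"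
    using assms
    by (simp only: prod_sgn_eq signed_perms_compose power_add mult.commute)
  then show ?thesis by (simp add: minus_one_power_iff split: if_splits)
qed

lemma even_signed_perms_compose:
  "\<pi> \<in> even_signed_perms n \<Longrightarrow> \<rho> \<in> even_signed_perms n \<Longrightarrow> \<pi> \<circ> \<rho> \<in> even_signed_perms n"
  by (simp add: even_signed_perms_def signed_perms_compose even_neg_compose)

lemma even_signed_perms_Suc_iff:
  "\<pi> \<in> even_signed_perms n \<longleftrightarrow> \<pi> \<in> even_signed_perms (Suc n) \<and> \<pi> (int (Suc n)) = int (Suc n)"
proof -
  have "neg n \<pi> = neg (Suc n) \<pi>" if "\<pi> (int (Suc n)) = int (Suc n)"
  proof -
    have "i \<noteq> int (Suc n)" if "\<pi> i < 0" for i
      using that \<open>\<pi> (int (Suc n)) = int (Suc n)\<close> by auto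
    then have "Neg n \<pi> = Neg (Suc n) \<pi>"
      by (force simp: Neg_def)
    then show ?thesis by (simp add: neg_def)
  qed
  then show ?thesis
    using signed_perms_Suc_iff[of \<pi> n] by (auto simp: even_signed_perms_def)
qed

lemma even_signed_perms_0: "even_signed_perms 0 = {id}"
  by (auto simp: even_signed_perms_def signed_perms_def neg_def Neg_def)

section \<open>The elements from which permutations are composed\<close>

text \<open>
  The cases \<open>\<bar>i\<bar> < j\<close> and \<open>i = -j\<close> have different shapes, so each gets its own evaluation rule;
  \<open>index_pairs_cases\<close> selects the one that applies.
\<close>

lemma signed_transp_apply:
  assumes "1 \<le> \<bar>i\<bar>" "\<bar>i\<bar> < j"
  shows "signed_transp i j x =
    (if x = i then j else if x = j then i else if x = - i then - j else if x = - j then - i else x)"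
  using assms by (auto simp: signed_transp_def transpose_def)

lemma signed_transp_apply_sign:
  assumes "1 < j"
  shows "signed_transp (- j) j x = (if \<bar>x\<bar> = 1 \<or> \<bar>x\<bar> = j then - x else x)"
  using assms by (auto simp: signed_transp_def transpose_def)

lemma index_pairs_cases:
  assumes "(i, j) \<in> index_pairs n"
  obtains "1 \<le> \<bar>i\<bar>" "\<bar>i\<bar> < j" "j \<le> int n" | "i = - j" "1 < j" "j \<le> int n"
  using assms by (auto simp: index_pairs_def)

lemma signed_transp_involution:
  assumes "(i, j) \<in> index_pairs n"
  shows "signed_transp i j \<circ> signed_transp i j = id"
  using assms
proof (cases rule: index_pairs_cases)
  case 1
  then show ?thesis by (auto simp: fun_eq_iff signed_transp_apply)
next
  case 2
  then show ?thesis by (auto simp: fun_eq_iff signed_transp_apply_sign)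
qed

lemma signed_transp_last:
  assumes "(i, j) \<in> index_pairs n"
  shows "signed_transp i j j = i" "signed_transp i j i = j"
  using assms
  by (cases rule: index_pairs_cases; force simp: signed_transp_apply signed_transp_apply_sign)+

lemma signed_transp_in_signed_perms:
  assumes ij: "(i, j) \<in> index_pairs n"
  shows "signed_transp i j \<in> signed_perms n"
proof -
  let ?t = "signed_transp i j"
  have outside: "?t x = x" if "x \<notin> {- int n..int n} - {0}" for x
    using ij that
    by (cases rule: index_pairs_cases) (auto simp: signed_transp_apply signed_transp_apply_sign)
  have inv: "?t (?t x) = x" for x
    using signed_transp_involution[OF ij] by (metis comp_apply id_apply)
  have "?t permutes ({- int n..int n} - {0})"
    unfolding permutes_def using outside inv by metis
  moreover have "?t (- x) = - ?t x" for x
    using ij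
    by (cases rule: index_pairs_cases) (auto simp: signed_transp_apply signed_transp_apply_sign)
  ultimately show ?thesis by (simp add: signed_perms_def)
qed

text \<open>
  Without signs, \<open>t\<^sub>i\<^sub>,\<^sub>j\<close> is the transposition of \<open>\<bar>i\<bar>\<close> and \<open>j\<close>, which degenerates to the identity
  for \<open>i = -j\<close>.
\<close>

lemma sign_abs_perm_signed_transp:
  assumes "(i, j) \<in> index_pairs n"
  shows "sign (abs_perm (signed_transp i j)) = (if i = - j then 1 else - 1)"
  using assms
proof (cases rule: index_pairs_cases)
  case 1
  then have "abs_perm (signed_transp i j) = transpose \<bar>i\<bar> j"
    by (auto simp: fun_eq_iff abs_perm_def signed_transp_apply transpose_def)
  then show ?thesis using 1 by (simp add: sign_swap_id)
next
  case 2
  then have "abs_perm (signed_transp i j) = id"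
    by (auto simp: fun_eq_iff abs_perm_def signed_transp_apply_sign)
  then show ?thesis using 2 by simp
qed

lemma signed_transp_in_even_signed_perms:
  assumes ij: "(i, j) \<in> index_pairs n"
  shows "signed_transp i j \<in> even_signed_perms n"
proof -
  have "Neg n (signed_transp i j) = (if i = - j then {1, j} else if i < 0 then {- i, j} else {})"
    using ij
    by (cases rule: index_pairs_cases)
      (auto simp: Neg_def signed_transp_apply signed_transp_apply_sign split: if_splits)
  moreover have "- i \<noteq> j" if "i \<noteq> - j" using that by auto
  moreover have "j \<noteq> 1" using ij by (cases rule: index_pairs_cases) auto
  ultimately have "even (neg n (signed_transp i j))"
    by (simp add: neg_def)
  then show ?thesis
    using signed_transp_in_signed_perms[OF ij] by (simp add: even_signed_perms_def)
qed

section \<open>The parity of the length\<close>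

text \<open>
  The length is a least element over all words for \<open>\<pi>\<close>, so it says nothing about \<open>\<pi>\<close> unless some
  word exists. It suffices that every \<open>t\<^sub>i\<^sub>,\<^sub>j\<close> is a product of generators. For \<open>\<bar>i\<bar> < j\<close> these
  elements are reached from the generators by conjugation, and \<open>t\<^sub>-\<^sub>j\<^sub>,\<^sub>j = t\<^sub>1\<^sub>,\<^sub>j t\<^sub>-\<^sub>1\<^sub>,\<^sub>j\<close>.
\<close>

inductive_set generated :: "nat \<Rightarrow> (int \<Rightarrow> int) set" for n where
  id: "id \<in> generated n"
| step: "g \<in> D_generators n \<Longrightarrow> \<pi> \<in> generated n \<Longrightarrow> g \<circ> \<pi> \<in> generated n"

lemma generated_word:
  "\<pi> \<in> generated n \<Longrightarrow> \<exists>ws. set ws \<subseteq> D_generators n \<and> compose_list ws = \<pi>"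
proof (induction rule: generated.induct)
  case id
  show ?case by (rule exI[of _ "[]"]) simp
next
  case (step g \<pi>)
  then obtain ws where "set ws \<subseteq> D_generators n" "compose_list ws = \<pi>" by blast
  then show ?case using step.hyps by (intro exI[of _ "g # ws"]) simp
qed

lemma generated_compose:
  "\<pi> \<in> generated n \<Longrightarrow> \<rho> \<in> generated n \<Longrightarrow> \<pi> \<circ> \<rho> \<in> generated n"
  by (induction rule: generated.induct) (simp_all add: comp_assoc generated.step)

lemma generated_generator: "g \<in> D_generators n \<Longrightarrow> g \<in> generated n"
  using generated.step[OF _ generated.id] by fastforce

text \<open>
  Conjugating by \<open>s = t\<^sub>a\<^sub>,\<^sub>b\<close> relabels the indices, \<open>s t\<^sub>i\<^sub>,\<^sub>j s = t\<^sub>s\<^sub>(\<^sub>i\<^sub>)\<^sub>,\<^sub>s\<^sub>(\<^sub>j\<^sub>)\<close>, because \<open>s\<close> is an odd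
  involution.
\<close>

lemma signed_transp_conj:
  assumes "1 \<le> \<bar>i\<bar>" "\<bar>i\<bar> < j" "1 \<le> \<bar>i'\<bar>" "\<bar>i'\<bar> < j'" "1 \<le> a" "a < b"
    and "signed_transp a b i = i'" "signed_transp a b j = j'"
  shows "signed_transp a b \<circ> (signed_transp i j \<circ> signed_transp a b) = signed_transp i' j'"
proof
  fix x
  let ?s = "signed_transp a b"
  have ab: "(a, b) \<in> index_pairs (nat b)"
    using assms by (simp add: index_pairs_def)
  have invol: "?s (?s y) = y" for y
    using signed_transp_involution[OF ab] by (metis comp_apply id_apply)
  have odd: "?s (- y) = - ?s y" for y
    using signed_perms_minus[OF signed_transp_in_signed_perms[OF ab]] .
  have iff: "?s x = y \<longleftrightarrow> x = ?s y" for y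
    using invol by metis
  have "?s (signed_transp i j (?s x)) = signed_transp i' j' x"
    unfolding signed_transp_apply[OF assms(1,2)] signed_transp_apply[OF assms(3,4)]
    by (simp only: iff odd assms(7,8) invol if_distrib[of ?s])
  then show "(?s \<circ> (signed_transp i j \<circ> ?s)) x = signed_transp i' j' x"
    by simp
qed

lemma adjacent_transp_generated:
  "1 \<le> a \<Longrightarrow> a < int n \<Longrightarrow> signed_transp a (a + 1) \<in> generated n"
  by (rule generated_generator) (auto simp: D_generators_def)

lemma signed_transp_pos_generated:
  assumes "1 \<le> i" "i < j" "j \<le> int n"
  shows "signed_transp i j \<in> generated n"
proof -
  have "i + 1 \<le> j" using assms by simp
  then show ?thesis using \<open>j \<le> int n\<close>
  proof (induction j rule: int_ge_induct)
    case base
    then show ?case using assms by (simp add: adjacent_transp_generated)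
  next
    case (step j)
    have "signed_transp j (j + 1) \<circ> (signed_transp i j \<circ> signed_transp j (j + 1))
        = signed_transp i (j + 1)"
      using step.hyps assms by (intro signed_transp_conj) (simp_all add: signed_transp_apply)
    moreover have "signed_transp j (j + 1) \<in> generated n"
      using step assms by (intro adjacent_transp_generated) auto
    moreover have "signed_transp i j \<in> generated n"
      using step by simp
    ultimately show ?case using generated_compose by metis
  qed
qed

lemma signed_transp_neg1_generated:
  assumes "1 < j" "j \<le> int n"
  shows "signed_transp (- 1) j \<in> generated n"
proof -
  have base: "signed_transp (- 1) 2 \<in> generated n"
    using assms by (intro generated_generator) (simp add: D_generators_def)
  show ?thesis
  proof (cases "j = 2")
    case True
    then show ?thesis using base by simp
  next
    case False
    then have j: "2 < j" using assms by simp
    have "signed_transp 2 j \<circ> (signed_transp (- 1) 2 \<circ> signed_transp 2 j) = signed_transp (- 1) j"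
      using j by (intro signed_transp_conj) (simp_all add: signed_transp_apply)
    moreover have "signed_transp 2 j \<in> generated n"
      using j assms by (intro signed_transp_pos_generated) simp_all
    ultimately show ?thesis using base generated_compose by metis
  qed
qed

lemma signed_transp_generated:
  assumes "(i, j) \<in> index_pairs n"
  shows "signed_transp i j \<in> generated n"
  using assms
proof (cases rule: index_pairs_cases)
  case 1
  consider "i > 0" | "i = - 1" | "i < - 1" using 1 by linarith
  then show ?thesis
  proof cases
    case 1
    with \<open>\<bar>i\<bar> < j\<close> \<open>j \<le> int n\<close> show ?thesis by (intro signed_transp_pos_generated) auto
  next
    case 2
    with \<open>\<bar>i\<bar> < j\<close> \<open>j \<le> int n\<close> show ?thesis by (simp add: signed_transp_neg1_generated)
  next
    case 3
    have "signed_transp 1 (- i) \<circ> (signed_transp (- 1) j \<circ> signed_transp 1 (- i))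
        = signed_transp i j"
      using 3 \<open>\<bar>i\<bar> < j\<close> by (intro signed_transp_conj) (simp_all add: signed_transp_apply)
    moreover have "signed_transp 1 (- i) \<in> generated n"
      using 3 \<open>\<bar>i\<bar> < j\<close> \<open>j \<le> int n\<close> by (intro signed_transp_pos_generated) auto
    moreover have "signed_transp (- 1) j \<in> generated n"
      using 3 \<open>\<bar>i\<bar> < j\<close> \<open>j \<le> int n\<close> by (intro signed_transp_neg1_generated) auto
    ultimately show ?thesis using generated_compose by metis
  qed
next
  case 2
  have "signed_transp 1 j \<circ> signed_transp (- 1) j = signed_transp i j"
  proof
    fix x
    consider "x = 1" | "x = - 1" | "x = j" | "x = - j" | "\<bar>x\<bar> \<noteq> 1" "\<bar>x\<bar> \<noteq> j" by linarith
    then show "(signed_transp 1 j \<circ> signed_transp (- 1) j) x = signed_transp i j x"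
      using 2 by cases (auto simp: signed_transp_apply signed_transp_apply_sign)
  qed
  moreover have "signed_transp 1 j \<in> generated n"
    using 2 by (intro signed_transp_pos_generated) simp_all
  moreover have "signed_transp (- 1) j \<in> generated n"
    using 2 by (intro signed_transp_neg1_generated) simp_all
  ultimately show ?thesis using generated_compose by metis
qed

lemma D_generators_reflection:
  assumes "g \<in> D_generators n"
  obtains i j where "(i, j) \<in> index_pairs n" "i \<noteq> - j" "g = signed_transp i j"
proof -
  have "\<exists>i j. (i, j) \<in> index_pairs n \<and> i \<noteq> - j \<and> g = signed_transp i j"
  proof (cases "n \<ge> 2 \<and> g = signed_transp (- 1) 2")
    case True
    then show ?thesis by (intro exI[of _ "- 1"] exI[of _ 2]) (auto simp: index_pairs_def)
  next
    case False
    then obtain i where "g = signed_transp i (i + 1)" "1 \<le> i" "i \<le> int n - 1"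
      using assms by (auto simp: D_generators_def split: if_splits)
    then show ?thesis by (intro exI[of _ i] exI[of _ "i + 1"]) (auto simp: index_pairs_def)
  qed
  then show ?thesis using that by blast
qed

text \<open>
  All generators have character \<open>-1\<close>, so any word, in particular a shortest one, has the parity
  given by the character.
\<close>

lemma length_D_parity:
  assumes "\<pi> \<in> generated n"
  shows "(- 1) ^ length_D n \<pi> = sign (abs_perm \<pi>)"
proof -
  have "\<exists>ws. set ws \<subseteq> D_generators n \<and> length ws = length_D n \<pi> \<and> compose_list ws = \<pi>"
    unfolding length_D_def
    by (rule LeastI_ex) (use generated_word[OF assms] in blast)
  then obtain ws where ws: "set ws \<subseteq> D_generators n" "length ws = length_D n \<pi>" "compose_list ws = \<pi>"
    by blast
  have gen: "g \<in> signed_perms n \<and> sign (abs_perm g) = - 1" if "g \<in> D_generators n" for g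
    using D_generators_reflection[OF that]
    by (metis sign_abs_perm_signed_transp signed_transp_in_signed_perms)
  then have "sign (abs_perm \<pi>) = (\<Prod>w\<leftarrow>ws. sign (abs_perm w))"
    using ws sign_abs_perm_compose_list[of ws n] by blast
  also have "\<dots> = (\<Prod>w\<leftarrow>ws. - 1)"
    using ws(1) gen by (intro arg_cong[where f = prod_list] map_cong) auto
  also have "\<dots> = (- 1) ^ length_D n \<pi>"
    using ws(2) by (simp add: map_replicate_const)
  finally show ?thesis by simp
qed

section \<open>Unique factorization\<close>

definition factor_lists :: "nat \<Rightarrow> (int \<times> int) list set" where
  "factor_lists n = {ps. set ps \<subseteq> index_pairs n \<and> sorted_wrt (<) (map snd ps)}"

abbreviation factor_prod :: "(int \<times> int) list \<Rightarrow> int \<Rightarrow> int" where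
  "factor_prod ps \<equiv> compose_list (map (\<lambda>(i, j). signed_transp i j) ps)"

definition top_indices :: "nat \<Rightarrow> int set" where
  "top_indices n = {i. (i, int n) \<in> index_pairs n}"

lemma index_pairs_0: "index_pairs 0 = {}"
  by (auto simp: index_pairs_def)

lemma index_pairs_Suc:
  "index_pairs (Suc n) = index_pairs n \<union> (\<lambda>i. (i, int (Suc n))) ` top_indices (Suc n)"
  by (auto simp: index_pairs_def top_indices_def)

lemma index_pairs_snd_le: "(i, j) \<in> index_pairs n \<Longrightarrow> j \<le> int n"
  by (auto elim: index_pairs_cases)

lemma factor_lists_0: "factor_lists 0 = {[]}"
  by (auto simp: factor_lists_def index_pairs_0)

text \<open>
  Second indices increase strictly, so \<open>n + 1\<close> can occur only in the last pair.
\<close>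

lemma factor_lists_Suc:
  "factor_lists (Suc n) = factor_lists n \<union>
     (\<lambda>(i, ps). ps @ [(i, int (Suc n))]) ` (top_indices (Suc n) \<times> factor_lists n)"
  (is "_ = _ \<union> ?B")
proof (intro equalityI subsetI)
  fix qs assume qs: "qs \<in> factor_lists (Suc n)"
  show "qs \<in> factor_lists n \<union> ?B"
  proof (cases qs rule: rev_cases)
    case Nil
    then show ?thesis by (simp add: factor_lists_def)
  next
    case (snoc ps p)
    obtain i j where p: "p = (i, j)" by fastforce
    have sorted: "sorted_wrt (<) (map snd ps)" and less: "\<And>r. r \<in> set ps \<Longrightarrow> snd r < j"
      and sub: "set ps \<subseteq> index_pairs (Suc n)" and ij: "(i, j) \<in> index_pairs (Suc n)"
      using qs snoc p by (auto simp: factor_lists_def sorted_wrt_append)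
    have "j \<le> int (Suc n)" using index_pairs_snd_le[OF ij] .
    then have "snd r \<noteq> int (Suc n)" if "r \<in> set ps" for r
      using less[OF that] by linarith
    then have ps: "set ps \<subseteq> index_pairs n"
      using sub unfolding index_pairs_Suc by fastforce
    show ?thesis
    proof (cases "j = int (Suc n)")
      case True
      then show ?thesis
        using snoc p ps sorted ij by (auto simp: factor_lists_def top_indices_def)
    next
      case False
      then have "(i, j) \<in> index_pairs n" using ij unfolding index_pairs_Suc by auto
      then show ?thesis using qs snoc p ps by (simp add: factor_lists_def)
    qed
  qed
next
  fix qs assume "qs \<in> factor_lists n \<union> ?B"
  then show "qs \<in> factor_lists (Suc n)"
    using index_pairs_snd_le
    by (fastforce simp: factor_lists_def index_pairs_Suc sorted_wrt_append)
qed

lemma inj_on_snoc: "inj_on (\<lambda>(i, ps). ps @ [(i, c)]) A"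
  by (auto simp: inj_on_def)

lemma factor_lists_disjoint:
  "factor_lists n \<inter> (\<lambda>(i, ps). ps @ [(i, int (Suc n))]) ` (A \<times> B) = {}"
  using index_pairs_snd_le by (fastforce simp: factor_lists_def)

lemma finite_top_indices: "finite (top_indices n)"
  by (rule finite_subset[of _ "{- int n..int n}"])
    (auto simp: top_indices_def index_pairs_def)

lemma finite_factor_lists: "finite (factor_lists n)"
  by (induction n) (simp_all add: factor_lists_0 factor_lists_Suc finite_top_indices)

lemma preimage_of_top:
  assumes \<rho>: "\<rho> \<in> signed_perms n" and i: "i \<in> top_indices (Suc n)"
  shows "(\<rho> \<circ> signed_transp i (int (Suc n))) i = int (Suc n)"
  using assms signed_transp_last(2)[of i "int (Suc n)" "Suc n"] signed_perms_fixes[OF \<rho>, of "int (Suc n)"]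
  by (simp add: top_indices_def)

lemma top_indices_less: "i \<in> top_indices n \<Longrightarrow> i < int n"
  by (auto simp: top_indices_def elim: index_pairs_cases)

text \<open>
  This is one step of the sorting algorithm. An element \<open>\<rho> \<circ> t\<^sub>i\<^sub>,\<^sub>n\<^sub>+\<^sub>1\<close> with \<open>\<rho> \<in> D\<^sub>n\<close> sends \<open>i\<close> to \<open>n + 1\<close>,
  so it determines \<open>i\<close> and thus \<open>\<rho>\<close>; conversely, if \<open>\<pi>\<close> sends \<open>i\<close> to \<open>n + 1\<close>, then
  \<open>\<pi> \<circ> t\<^sub>i\<^sub>,\<^sub>n\<^sub>+\<^sub>1\<close> fixes \<open>n + 1\<close>.
\<close>

lemma bij_betw_even_signed_perms_Suc:
  "bij_betw (\<lambda>(i, \<rho>). \<rho> \<circ> signed_transp i (int (Suc n)))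
     (top_indices (Suc n) \<times> even_signed_perms n)
     (even_signed_perms (Suc n) - even_signed_perms n)"
  (is "bij_betw ?f ?A ?B")
proof -
  let ?N = "int (Suc n)"
  have invol: "signed_transp i ?N \<circ> signed_transp i ?N = id" if "i \<in> top_indices (Suc n)" for i
    using that signed_transp_involution unfolding top_indices_def by blast
  have cancel: "\<pi> \<circ> signed_transp i ?N \<circ> signed_transp i ?N = \<pi>"
    if "i \<in> top_indices (Suc n)" for i and \<pi> :: "int \<Rightarrow> int"
    using invol[OF that] by (metis comp_assoc comp_id)
  have even_perm: "signed_transp i ?N \<in> even_signed_perms (Suc n)" if "i \<in> top_indices (Suc n)" for i
    using that signed_transp_in_even_signed_perms unfolding top_indices_def by blast
  show ?thesis
  proof (rule bij_betw_imageI)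
    show "inj_on ?f ?A"
    proof (rule inj_onI, clarify)
      fix i \<rho> i' \<rho>'
      assume i: "i \<in> top_indices (Suc n)" "i' \<in> top_indices (Suc n)"
        and \<rho>: "\<rho> \<in> even_signed_perms n" "\<rho>' \<in> even_signed_perms n"
        and eq: "\<rho> \<circ> signed_transp i ?N = \<rho>' \<circ> signed_transp i' ?N"
      have "(\<rho> \<circ> signed_transp i ?N) i = ?N" "(\<rho>' \<circ> signed_transp i' ?N) i' = ?N"
        using i \<rho> by (intro preimage_of_top; simp add: even_signed_perms_def)+
      then have "(\<rho> \<circ> signed_transp i ?N) i = (\<rho> \<circ> signed_transp i ?N) i'"
        using eq by (simp only:)
      moreover have "\<rho> \<circ> signed_transp i ?N \<in> signed_perms (Suc n)"
        using even_perm[OF i(1)] \<rho>(1) signed_perms_Suc_iff[of \<rho> n]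
        by (simp add: even_signed_perms_def signed_perms_compose)
      ultimately have "i = i'" using signed_perms_inject by blast
      then show "i = i' \<and> \<rho> = \<rho>'" using eq cancel i by metis
    qed
    show "?f ` ?A = ?B"
    proof (intro equalityI subsetI)
      fix \<pi> assume "\<pi> \<in> ?f ` ?A"
      then obtain i \<rho> where i: "i \<in> top_indices (Suc n)" and \<rho>: "\<rho> \<in> even_signed_perms n"
        and \<pi>: "\<pi> = \<rho> \<circ> signed_transp i ?N" by auto
      have "\<pi> \<in> even_signed_perms (Suc n)"
        unfolding \<pi> using \<rho> even_signed_perms_Suc_iff[of \<rho> n]
        by (intro even_signed_perms_compose even_perm i) blast
      moreover have "\<pi> ?N \<noteq> ?N"
        using calculation preimage_of_top[of \<rho> n i] i \<rho> \<pi> top_indices_less[OF i]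
          signed_perms_inject[of \<pi> "Suc n" i ?N]
        by (auto simp: even_signed_perms_def)
      ultimately show "\<pi> \<in> ?B" using even_signed_perms_Suc_iff by blast
    next
      fix \<pi> assume "\<pi> \<in> ?B"
      then have \<pi>: "\<pi> \<in> even_signed_perms (Suc n)" "\<pi> ?N \<noteq> ?N"
        using even_signed_perms_Suc_iff by blast+
      then have \<pi>s: "\<pi> \<in> signed_perms (Suc n)" by (simp add: even_signed_perms_def)
      obtain i where i: "\<pi> i = ?N"
        using permutes_surj[OF signed_perms_permutes[OF \<pi>s]] by (metis surjD)
      have "\<bar>i\<bar> \<le> ?N" "i \<noteq> 0" "i \<noteq> ?N"
        using signed_perms_abs_le_iff[OF \<pi>s, of i] signed_perms_eq_0_iff[OF \<pi>s, of i] i \<pi> by auto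
      moreover have "i \<noteq> - ?N \<or> n > 0"
      proof (rule ccontr)
        \<comment> \<open>For \<open>n = 0\<close> the index \<open>-1\<close> would be needed, but \<open>1 \<mapsto> -1\<close> is an odd element.\<close>
        assume "\<not> (i \<noteq> - ?N \<or> n > 0)"
        then have "n = 0" "i = - ?N" by simp_all
        then have "\<pi> 1 = - 1" using i signed_perms_minus[OF \<pi>s, of 1] by simp
        then have "Neg (Suc n) \<pi> = {1}" using \<open>n = 0\<close> by (auto simp: Neg_def)
        then show False using \<pi>(1) by (simp add: even_signed_perms_def neg_def)
      qed
      ultimately have it: "i \<in> top_indices (Suc n)"
        by (auto simp: top_indices_def index_pairs_def)
      let ?\<rho> = "\<pi> \<circ> signed_transp i ?N"
      have "?\<rho> ?N = ?N"
        using it i signed_transp_last(1)[of i ?N "Suc n"] by (simp add: top_indices_def)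
      then have "?\<rho> \<in> even_signed_perms n"
        using even_signed_perms_compose[OF \<pi>(1) even_perm[OF it]]
          even_signed_perms_Suc_iff[of ?\<rho> n] by blast
      then show "\<pi> \<in> ?f ` ?A"
        using it cancel[OF it, of \<pi>] by (intro image_eqI[of _ _ "(i, ?\<rho>)"]) simp_all
    qed
  qed
qed

text \<open>
  Elements of \<open>D\<^sub>n\<^sub>+\<^sub>1\<close> that fix \<open>n + 1\<close> form \<open>D\<^sub>n\<close> and come from lists without the second index
  \<open>n + 1\<close>; the others come from lists that end with it.
\<close>

lemma bij_betw_factor_prod: "bij_betw factor_prod (factor_lists n) (even_signed_perms n)"
proof (induction n)
  case 0
  show ?case by (simp add: factor_lists_0 even_signed_perms_0 bij_betw_def)
next
  case (Suc n)
  let ?T = "top_indices (Suc n)" and ?N = "int (Suc n)"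
  let ?snoc = "\<lambda>(i, ps). ps @ [(i, ?N)]"
  have "bij_betw ((\<lambda>(i, \<rho>). \<rho> \<circ> signed_transp i ?N) \<circ> map_prod id factor_prod)
      (?T \<times> factor_lists n) (even_signed_perms (Suc n) - even_signed_perms n)"
    using bij_betw_trans[OF bij_betw_map_prod[OF bij_betw_id Suc] bij_betw_even_signed_perms_Suc] .
  also have "(\<lambda>(i, \<rho>). \<rho> \<circ> signed_transp i ?N) \<circ> map_prod id factor_prod = factor_prod \<circ> ?snoc"
    by (auto simp: fun_eq_iff)
  finally have "bij_betw factor_prod (?snoc ` (?T \<times> factor_lists n))
      (even_signed_perms (Suc n) - even_signed_perms n)"
    by (rule iffD2[OF bij_betw_comp_iff[OF inj_on_imp_bij_betw[OF inj_on_snoc]]])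
  then have "bij_betw factor_prod (factor_lists (Suc n))
      (even_signed_perms n \<union> (even_signed_perms (Suc n) - even_signed_perms n))"
    unfolding factor_lists_Suc by (intro bij_betw_combine[OF Suc] Diff_disjoint)
  moreover have "even_signed_perms n \<subseteq> even_signed_perms (Suc n)"
    using even_signed_perms_Suc_iff by blast
  ultimately show ?case by (simp add: Un_absorb1)
qed

section \<open>The generating function\<close>

text \<open>The contribution of a single factor to \<open>(-1)^length_D * q^sor_D\<close>.\<close>

definition factor_weight :: "'a::comm_ring_1 \<Rightarrow> int \<times> int \<Rightarrow> 'a" where
  "factor_weight q = (\<lambda>(i, j).
     (if i = - j then 1 else - 1) * q ^ nat (j - i - 2 * of_bool (i < 0)))"

lemma sor_D_factor_prod:
  assumes ps: "ps \<in> factor_lists n"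
  shows "sor_D n (factor_prod ps) = nat (\<Sum>(i, j)\<leftarrow>ps. j - i - 2 * of_bool (i < 0))"
proof -
  have "(THE qs. is_factorization n (factor_prod ps) qs) = ps"
  proof (rule the_equality)
    show "is_factorization n (factor_prod ps) ps"
      using ps by (simp add: is_factorization_def factor_lists_def)
    fix qs assume "is_factorization n (factor_prod ps) qs"
    then have "qs \<in> factor_lists n" "factor_prod qs = factor_prod ps"
      by (simp_all add: is_factorization_def factor_lists_def)
    then show "qs = ps"
      using ps bij_betw_imp_inj_on[OF bij_betw_factor_prod] by (metis inj_onD)
  qed
  then show ?thesis by (simp add: sor_D_def)
qed

text \<open>
  The sorting index truncates only the total to a natural number. Splitting the power into a
  product truncates every summand, which needs nonnegativity throughout; the claim
  \<open>0 \<le> \<dots>\<close> is there for the induction.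
\<close>

lemma power_sorting_sum:
  fixes q :: "'a::comm_ring_1"
  assumes "set ps \<subseteq> index_pairs n"
  shows "0 \<le> (\<Sum>(i, j)\<leftarrow>ps. j - i - 2 * of_bool (i < 0)) \<and>
    q ^ nat (\<Sum>(i, j)\<leftarrow>ps. j - i - 2 * of_bool (i < 0))
     = (\<Prod>(i, j)\<leftarrow>ps. q ^ nat (j - i - 2 * of_bool (i < 0)))"
  using assms
proof (induction ps)
  case (Cons p ps)
  obtain i j where p: "p = (i, j)" by fastforce
  with Cons.prems have "(i, j) \<in> index_pairs n" by simp
  then have "0 \<le> j - i - 2 * of_bool (i < 0)"
    by (cases rule: index_pairs_cases) auto
  then show ?case using Cons p by (simp add: nat_add_distrib power_add)
qed simp

lemma sign_abs_perm_factor_prod: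
  assumes "set ps \<subseteq> index_pairs n"
  shows "sign (abs_perm (factor_prod ps)) = (\<Prod>(i, j)\<leftarrow>ps. if i = - j then 1 else - 1)"
proof -
  have "sign (abs_perm (factor_prod ps))
      = (\<Prod>w\<leftarrow>map (\<lambda>(i, j). signed_transp i j) ps. sign (abs_perm w))"
    using assms signed_transp_in_signed_perms
    by (intro sign_abs_perm_compose_list[of _ n]) auto
  also have "\<dots> = (\<Prod>(i, j)\<leftarrow>ps. if i = - j then 1 else - 1)"
    unfolding map_map using assms sign_abs_perm_signed_transp
    by (intro arg_cong[where f = prod_list] map_cong) auto
  finally show ?thesis .
qed

lemma factor_prod_generated:
  "set ps \<subseteq> index_pairs n \<Longrightarrow> factor_prod ps \<in> generated n"
  by (induction ps) (auto intro: generated.id generated_compose signed_transp_generated)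

lemma signed_term_eq_weight_prod:
  fixes q :: "'a::comm_ring_1"
  assumes ps: "ps \<in> factor_lists n"
  shows "(- 1) ^ length_D n (factor_prod ps) * q ^ sor_D n (factor_prod ps)
    = (\<Prod>p\<leftarrow>ps. factor_weight q p)"
proof -
  have sub: "set ps \<subseteq> index_pairs n" using ps by (simp add: factor_lists_def)
  have "(- 1 :: 'a) ^ length_D n (factor_prod ps) = of_int (sign (abs_perm (factor_prod ps)))"
    by (simp flip: length_D_parity[OF factor_prod_generated[OF sub]])
  also have "\<dots> = (\<Prod>(i, j)\<leftarrow>ps. if i = - j then 1 else - 1)"
    unfolding sign_abs_perm_factor_prod[OF sub] by (induction ps) auto
  finally have "(- 1) ^ length_D n (factor_prod ps) * q ^ sor_D n (factor_prod ps)
     = (\<Prod>(i, j)\<leftarrow>ps. if i = - j then 1 else - 1) *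
       (\<Prod>(i, j)\<leftarrow>ps. q ^ nat (j - i - 2 * of_bool (i < 0)))"
    using sor_D_factor_prod[OF ps] power_sorting_sum[OF sub, of q] by simp
  also have "\<dots> = (\<Prod>p\<leftarrow>ps. factor_weight q p)"
    by (induction ps) (auto simp: factor_weight_def mult_ac)
  finally show ?thesis .
qed

lemma sum_factor_lists_Suc:
  fixes w :: "int \<times> int \<Rightarrow> 'a::comm_ring_1"
  shows "(\<Sum>ps\<in>factor_lists (Suc n). \<Prod>p\<leftarrow>ps. w p)
    = (\<Sum>ps\<in>factor_lists n. \<Prod>p\<leftarrow>ps. w p)
      * (1 + (\<Sum>i\<in>top_indices (Suc n). w (i, int (Suc n))))"
proof -
  let ?T = "top_indices (Suc n)" and ?W = "\<lambda>ps. \<Prod>p\<leftarrow>ps. w p"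
  let ?snoc = "\<lambda>(i, ps). ps @ [(i, int (Suc n))]"
  have "sum ?W (factor_lists (Suc n))
      = sum ?W (factor_lists n) + sum ?W (?snoc ` (?T \<times> factor_lists n))"
    unfolding factor_lists_Suc
    by (intro sum.union_disjoint factor_lists_disjoint)
      (simp_all add: finite_factor_lists finite_top_indices)
  also have "sum ?W (?snoc ` (?T \<times> factor_lists n))
      = (\<Sum>(i, ps)\<in>?T \<times> factor_lists n. w (i, int (Suc n)) * ?W ps)"
    unfolding sum.reindex[OF inj_on_snoc] by (intro sum.cong) (auto simp: mult.commute)
  also have "\<dots> = (\<Sum>i\<in>?T. w (i, int (Suc n))) * sum ?W (factor_lists n)"
    by (simp add: sum_product sum.cartesian_product)
  finally show ?thesis by (simp add: algebra_simps)
qed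

text \<open>
  The factor for \<open>k = m + 2\<close>. The sets \<open>P\<close> and \<open>M\<close> of positive and negative first indices are
  both enumerated by increasing exponent of \<open>q\<close>, which turns each sum into a multiple of
  \<open>[k-1]\<^sub>q\<close>. The first exponents are \<open>1\<close> and \<open>k-1\<close>.
\<close>

lemma sum_top_indices:
  fixes q :: "'a::comm_ring_1"
  shows "1 + (\<Sum>i\<in>top_indices (Suc (Suc m)). factor_weight q (i, int (Suc (Suc m))))
    = 1 - (q + q ^ Suc m) * qint q (Suc m) + q ^ (2 * Suc m)"
proof -
  let ?w = "\<lambda>i. factor_weight q (i, int (Suc (Suc m)))"
  define P where "P = (\<lambda>l. int (Suc m) - int l) ` {..<Suc m}"
  define M where "M = (\<lambda>l. - 1 - int l) ` {..<Suc m}"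
  have P_iff: "x \<in> P \<longleftrightarrow> 1 \<le> x \<and> x \<le> int (Suc m)" for x
  proof
    assume "1 \<le> x \<and> x \<le> int (Suc m)"
    then show "x \<in> P"
      unfolding P_def by (intro image_eqI[of _ _ "nat (int (Suc m) - x)"]) auto
  qed (auto simp: P_def)
  have M_iff: "x \<in> M \<longleftrightarrow> - int (Suc m) \<le> x \<and> x \<le> - 1" for x
  proof
    assume "- int (Suc m) \<le> x \<and> x \<le> - 1"
    then show "x \<in> M"
      unfolding M_def by (intro image_eqI[of _ _ "nat (- 1 - x)"]) auto
  qed (auto simp: M_def)
  have top: "top_indices (Suc (Suc m)) = insert (- int (Suc (Suc m))) (P \<union> M)"
    unfolding set_eq_iff by (auto simp: P_iff M_iff top_indices_def index_pairs_def)
  have fin: "finite P" "finite M" "P \<inter> M = {}" "- int (Suc (Suc m)) \<notin> P \<union> M"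
    by (simp_all add: P_def M_def) (auto simp: P_iff[unfolded P_def] M_iff[unfolded M_def])
  have "sum ?w P = (\<Sum>l<Suc m. - (q * q ^ l))"
    unfolding P_def
    by (subst sum.reindex) (auto simp: inj_on_def factor_weight_def nat_add_distrib intro!: sum.cong)
  then have P: "sum ?w P = - (q * qint q (Suc m))"
    by (simp only: qint_def sum_negf sum_distrib_left)
  have w_M: "?w (- 1 - int l) = - (q ^ Suc m * q ^ l)" if "l < Suc m" for l
  proof -
    have "nat (int (Suc (Suc m)) - (- 1 - int l) - 2 * of_bool (- 1 - int l < 0)) = Suc m + l"
      by simp
    moreover have "- 1 - int l \<noteq> - int (Suc (Suc m))" using that by simp
    ultimately show ?thesis
      by (simp only: factor_weight_def case_prod_conv if_False power_add mult_minus_left mult_1)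
  qed
  have "sum ?w M = (\<Sum>l<Suc m. ?w (- 1 - int l))"
    unfolding M_def by (subst sum.reindex) (simp_all add: inj_on_def)
  also have "\<dots> = (\<Sum>l<Suc m. - (q ^ Suc m * q ^ l))"
    using w_M by (intro sum.cong) simp_all
  finally have "sum ?w M = (\<Sum>l<Suc m. - (q ^ Suc m * q ^ l))" .
  then have M: "sum ?w M = - (q ^ Suc m * qint q (Suc m))"
    by (simp only: qint_def sum_negf sum_distrib_left)
  have "nat (int (Suc (Suc m)) - (- int (Suc (Suc m))) - 2 * of_bool (- int (Suc (Suc m)) < 0))
      = 2 * Suc m"
    by simp
  then have "?w (- int (Suc (Suc m))) = q ^ (2 * Suc m)"
    by (simp only: factor_weight_def case_prod_conv if_True simp_thms mult_1)
  then show ?thesis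
    using fin by (simp only: top sum.insert sum.union_disjoint finite_Un simp_thms P M)
      (simp add: algebra_simps)
qed

theorem theorem4p3:
  fixes q :: "'a::comm_ring_1" and n :: nat
  shows "(\<Sum>\<pi>\<in>even_signed_perms n. (- 1) ^ length_D n \<pi> * q ^ sor_D n \<pi>)
    = (\<Prod>k=2..n. 1 - (q + q ^ (k - 1)) * qint q (k - 1) + q ^ (2 * k - 2))"
proof -
  have "(\<Sum>\<pi>\<in>even_signed_perms n. (- 1) ^ length_D n \<pi> * q ^ sor_D n \<pi>)
      = (\<Sum>ps\<in>factor_lists n. \<Prod>p\<leftarrow>ps. factor_weight q p)"
    by (subst sum.reindex_bij_betw[OF bij_betw_factor_prod, symmetric])
      (simp add: signed_term_eq_weight_prod)
  also have "\<dots> = (\<Prod>k=2..n. 1 - (q + q ^ (k - 1)) * qint q (k - 1) + q ^ (2 * k - 2))"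
  proof (induction n)
    case 0
    show ?case by (simp add: factor_lists_0)
  next
    case (Suc n)
    show ?case
    proof (cases n)
      case 0
      \<comment> \<open>There is no factor with second index \<open>1\<close>, so the product starts at \<open>k = 2\<close>.\<close>
      have "top_indices (Suc 0) = {}" by (auto simp: top_indices_def index_pairs_def)
      then show ?thesis using 0 by (simp add: sum_factor_lists_Suc factor_lists_0)
    next
      case (Suc m)
      then have "(\<Prod>k=2..Suc n. 1 - (q + q ^ (k - 1)) * qint q (k - 1) + q ^ (2 * k - 2))
          = (\<Prod>k=2..n. 1 - (q + q ^ (k - 1)) * qint q (k - 1) + q ^ (2 * k - 2))
            * (1 - (q + q ^ n) * qint q n + q ^ (2 * n))"
        by (simp add: prod.nat_ivl_Suc' mult.commute)
      then show ?thesis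
        using Suc.IH sum_top_indices[of q m] Suc
        by (simp only: sum_factor_lists_Suc)
    qed
  qed
  finally show ?thesis .
qed

end
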